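(* Let $\mathcal{E}$ be a quantum channel on a $d$-dimensional complex Hilbert space $\mathcal{H}$, and let $|v_1\rangle,|v_2\rangle\in\mathcal{H}$ be unit vectors such that the pure states $|v_1\rangle\langle v_1|$ and $|v_2\rangle\langle v_2|$ are non-adjacent with respect to some POVM on $\mathcal{H}$. Then $\langle v_1|v_2\rangle=0$.
   Context: A quantum channel is a completely positive trace-preserving linear map $\mathcal{E}(\rho)=\sum_a E_a\rho E_a^\dagger$ with finitely many operators $E_a$ on $\mathcal{H}$ satisfying $\sum_a E_a^\dagger E_a=\mathbb{1}$. A POVM is a finite family $\{M_1,\dots,M_m\}$ of positive semidefinite operators on $\mathcal{H}$ with $\sum_j M_j=\mathbb{1}$. For a fixed channel $\mathcal{E}$, two states (positive semidefinite trace-one operators) $\rho_1,\rho_2$ are non-adjacent with respect to a POVM $\{M_j\}_{j=1}^m$ if $A_1\cap A_2=\emptyset$, where $A_k=\{j\in\{1,\dots,m\} : \mathrm{tr}[\mathcal{E}(\rho_k)M_j]>0\}$ for $k=1,2$. *)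

theory Defs
  imports "HOL-Analysis.Analysis" "HOL-Library.Complex_Order"
begin

text \<open>
  The \<open>d\<close>-dimensional Hilbert space is \<open>complex ^ 'n\<close> with \<open>d = CARD('n)\<close>, and operators on it are
  matrices \<open>complex ^ 'n ^ 'n\<close>.  The library's \<open>inner\<close> on \<open>complex ^ 'n\<close> is real-valued, so the
  Hermitian product is defined here, with the physics convention (conjugate-linear in the
  first argument); it induces the library's \<open>norm\<close> (\<open>braket_self\<close> below).
  Inequalities between complex numbers use the order of \<open>Complex_Order\<close>: \<open>0 \<le> z\<close> says
  that \<open>z\<close> is real and nonnegative.
\<close>

definition braket :: "complex ^ 'n \<Rightarrow> complex ^ 'n \<Rightarrow> complex"
  where "braket v w = (\<Sum>i\<in>UNIV. cnj (v $ i) * w $ i)"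

definition ketbra :: "complex ^ 'n \<Rightarrow> complex ^ 'n \<Rightarrow> complex ^ 'n ^ 'n"
  where "ketbra v w = (\<chi> i j. v $ i * cnj (w $ j))"

definition hermitian_adjoint :: "complex ^ 'n ^ 'n \<Rightarrow> complex ^ 'n ^ 'n"
  where "hermitian_adjoint A = (\<chi> i j. cnj (A $ j $ i))"

text \<open>Since \<open>0 \<le> z\<close> forces \<open>z\<close> to be real, positive semidefinite matrices are Hermitian.\<close>

definition psd :: "complex ^ 'n ^ 'n \<Rightarrow> bool"
  where "psd A \<longleftrightarrow> (\<forall>v. 0 \<le> braket v (A *v v))"

definition density_operator :: "complex ^ 'n ^ 'n \<Rightarrow> bool"
  where "density_operator \<rho> \<longleftrightarrow> psd \<rho> \<and> trace \<rho> = 1"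

definition quantum_channel :: "(complex ^ 'n ^ 'n \<Rightarrow> complex ^ 'n ^ 'n) \<Rightarrow> bool"
  where "quantum_channel \<E> \<longleftrightarrow>
    (\<exists>(r::nat) E. (\<Sum>a=1..r. hermitian_adjoint (E a) ** E a) = mat 1 \<and>
       (\<forall>\<rho>. \<E> \<rho> = (\<Sum>a=1..r. E a ** \<rho> ** hermitian_adjoint (E a))))"

definition povm :: "nat \<Rightarrow> (nat \<Rightarrow> complex ^ 'n ^ 'n) \<Rightarrow> bool"
  where "povm m M \<longleftrightarrow> (\<forall>j\<in>{1..m}. psd (M j)) \<and> (\<Sum>j=1..m. M j) = mat 1"

definition possible_outcomes ::
    "(complex ^ 'n ^ 'n \<Rightarrow> complex ^ 'n ^ 'n) \<Rightarrow> nat \<Rightarrow> (nat \<Rightarrow> complex ^ 'n ^ 'n)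
      \<Rightarrow> complex ^ 'n ^ 'n \<Rightarrow> nat set"
  where "possible_outcomes \<E> m M \<rho> = {j \<in> {1..m}. trace (\<E> \<rho> ** M j) > 0}"

definition non_adjacent ::
    "(complex ^ 'n ^ 'n \<Rightarrow> complex ^ 'n ^ 'n) \<Rightarrow> nat \<Rightarrow> (nat \<Rightarrow> complex ^ 'n ^ 'n)
      \<Rightarrow> complex ^ 'n ^ 'n \<Rightarrow> complex ^ 'n ^ 'n \<Rightarrow> bool"
  where "non_adjacent \<E> m M \<rho>\<^sub>1 \<rho>\<^sub>2 \<longleftrightarrow>
    density_operator \<rho>\<^sub>1 \<and> density_operator \<rho>\<^sub>2 \<and>
    possible_outcomes \<E> m M \<rho>\<^sub>1 \<inter> possible_outcomes \<E> m M \<rho>\<^sub>2 = {}"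

lemma braket_self: "braket v v = complex_of_real ((norm v)\<^sup>2)"
  by (simp add: braket_def norm_vec_def L2_set_def sum_nonneg complex_norm_square mult.commute
      del: of_real_power)

lemma braket_ketbra: "braket u (ketbra v w *v u) = braket u v * cnj (braket u w)"
  by (simp add: braket_def ketbra_def matrix_vector_mult_def sum_distrib_left sum_distrib_right
      mult.assoc mult.left_commute mult.commute)

text \<open>The requirement in \<open>non_adjacent\<close> that both arguments be states is automatic for
  pure states.\<close>

lemma density_operator_ketbra:
  assumes "norm v = 1"
  shows "density_operator (ketbra v v)"
proof -
  have "trace (ketbra v v) = braket v v"
    by (simp add: trace_def ketbra_def braket_def mult.commute)
  moreover have "psd (ketbra v v)"
    unfolding psd_def braket_ketbra complex_norm_square[symmetric]
    by (simp add: less_eq_complex_def)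
  ultimately show ?thesis
    using assms by (simp add: density_operator_def braket_self)
qed

end

theory Submission
  imports Defs
begin

text \<open>
  Since \<open>\<Sum>a E\<^sub>a\<^sup>\<dagger> E\<^sub>a = 1\<close> and \<open>\<Sum>j M\<^sub>j = 1\<close>, the inner product \<open>\<langle>v\<^sub>1|v\<^sub>2\<rangle>\<close> is the sum over
  \<open>a\<close> and \<open>j\<close> of \<open>\<langle>E\<^sub>a v\<^sub>1|M\<^sub>j|E\<^sub>a v\<^sub>2\<rangle>\<close>.  For each \<open>j\<close>, one of the two outcome probabilities
  \<open>\<Sum>a \<langle>E\<^sub>a v\<^sub>k|M\<^sub>j|E\<^sub>a v\<^sub>k\<rangle>\<close> is zero, hence so are all its nonnegative summands.  By
  positivity of \<open>M\<^sub>j\<close> this kills all the terms \<open>\<langle>E\<^sub>a v\<^sub>1|M\<^sub>j|E\<^sub>a v\<^sub>2\<rangle>\<close> as well.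
\<close>

lemma braket_add_left: "braket (u + v) w = braket u w + braket v w"
  by (simp add: braket_def distrib_right sum.distrib)

lemma braket_add_right: "braket u (v + w) = braket u v + braket u w"
  by (simp add: braket_def distrib_left sum.distrib)

lemma braket_scale_left: "braket (c *s v) w = cnj c * braket v w"
  by (simp add: braket_def sum_distrib_left mult.assoc)

lemma braket_scale_right: "braket v (c *s w) = c * braket v w"
  by (simp add: braket_def sum_distrib_left mult.left_commute)

lemma braket_sum_right: "braket v (\<Sum>a\<in>I. f a) = (\<Sum>a\<in>I. braket v (f a))"
  unfolding braket_def by (simp add: sum_distrib_left) (rule sum.swap)

lemma sum_matrix_vector_mult:
  fixes A :: "'i \<Rightarrow> complex ^ 'n ^ 'm"
  shows "(\<Sum>a\<in>I. A a) *v v = (\<Sum>a\<in>I. A a *v v)"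
  by (induction I rule: infinite_finite_induct) (simp_all add: matrix_vector_mult_add_rdistrib)

lemma sum_matrix_matrix_mult:
  fixes A :: "'i \<Rightarrow> complex ^ 'n ^ 'm"
  shows "(\<Sum>a\<in>I. A a) ** B = (\<Sum>a\<in>I. A a ** B)"
  by (induction I rule: infinite_finite_induct)
    (simp_all add: matrix_matrix_mult_def vec_eq_iff distrib_right sum.distrib)

lemma trace_sum:
  fixes A :: "'i \<Rightarrow> complex ^ 'n ^ 'n"
  shows "trace (\<Sum>a\<in>I. A a) = (\<Sum>a\<in>I. trace (A a))"
  unfolding trace_def by simp (rule sum.swap)

lemma braket_matrix_left: "braket (A *v v) w = braket v (hermitian_adjoint A *v w)"
proof -
  have "braket (A *v v) w = (\<Sum>i\<in>UNIV. \<Sum>j\<in>UNIV. cnj (A $ i $ j) * cnj (v $ j) * w $ i)"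
    by (simp add: braket_def matrix_vector_mult_def sum_distrib_right)
  also have "\<dots> = (\<Sum>j\<in>UNIV. \<Sum>i\<in>UNIV. cnj (A $ i $ j) * cnj (v $ j) * w $ i)"
    by (rule sum.swap)
  also have "\<dots> = braket v (hermitian_adjoint A *v w)"
    by (simp add: braket_def matrix_vector_mult_def hermitian_adjoint_def sum_distrib_left
        mult.assoc mult.left_commute)
  finally show ?thesis .
qed

lemma ketbra_conjugation:
  "A ** ketbra v w ** hermitian_adjoint A = ketbra (A *v v) (A *v w)"
  by (simp add: vec_eq_iff ketbra_def hermitian_adjoint_def matrix_matrix_mult_def
      matrix_vector_mult_def sum_distrib_left sum_distrib_right mult.assoc mult.left_commute
      mult.commute)

lemma trace_ketbra_mult: "trace (ketbra v w ** A) = braket w (A *v v)"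
proof -
  have "trace (ketbra v w ** A) = (\<Sum>i\<in>UNIV. \<Sum>j\<in>UNIV. v $ i * cnj (w $ j) * A $ j $ i)"
    by (simp add: trace_def ketbra_def matrix_matrix_mult_def)
  also have "\<dots> = (\<Sum>j\<in>UNIV. \<Sum>i\<in>UNIV. v $ i * cnj (w $ j) * A $ j $ i)"
    by (rule sum.swap)
  also have "\<dots> = braket w (A *v v)"
    by (simp add: braket_def matrix_vector_mult_def sum_distrib_left mult.assoc mult.left_commute
        mult.commute)
  finally show ?thesis .
qed

text \<open>Along the complex line \<open>u + t *s w\<close> the form of \<open>A\<close> has no
  \<bar>t\<bar>^2 term, because that coefficient is the vanishing \<open>braket w (A *v w)\<close>.
  What remains is real-affine in t, and it can stay nonnegative for every t only if it is
  constant.\<close>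

lemma psd_braket_eq_0:
  assumes "psd A" and w: "braket w (A *v w) = 0"
  shows "braket u (A *v w) = 0" and "braket w (A *v u) = 0"
proof -
  define a b c where "a = braket u (A *v w)" and "b = braket w (A *v u)"
    and "c = braket u (A *v u)"
  have pos: "0 \<le> c + t * a + cnj t * b" for t
  proof -
    have "0 \<le> braket (u + t *s w) (A *v (u + t *s w))"
      using assms(1) by (simp add: psd_def)
    also have "\<dots> = c + t * a + cnj t * b"
      using w by (simp add: a_def b_def c_def matrix_vector_right_distrib vector_scalar_commute
          braket_add_left braket_add_right braket_scale_left braket_scale_right)
    finally show ?thesis .
  qed
  \<comment> \<open>The three values are real: t = 0 gives Im c = 0, t = 1 gives Im a = - Im b, and
    t = i gives Re a = Re b.\<close>
  have b: "b = cnj a"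
    using pos[of 0] pos[of 1] pos[of \<i>] by (simp add: less_eq_complex_def complex_eq_iff)
  have "a = 0"
  proof (rule ccontr)
    assume "a \<noteq> 0"
    \<comment> \<open>The terms \<open>t * a\<close> and \<open>cnj t * b\<close> are conjugate, so
      each contributes - (Re c + 1) / 2 to the real part; the total is -1, contradicting
      \<open>pos\<close>.\<close>
    define t where "t = - (complex_of_real (Re c + 1) / (2 * a))"
    have "t * a = complex_of_real (- (Re c + 1) / 2)"
      using \<open>a \<noteq> 0\<close> by (simp add: t_def field_simps)
    then have "Re (t * a) = - (Re c + 1) / 2" by (metis Re_complex_of_real)
    moreover have "Re (cnj t * b) = Re (t * a)"
      by (simp add: b)
    ultimately show False
      using pos[of t] by (simp add: less_eq_complex_def del: times_complex.sel)
  qed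
  then show "braket u (A *v w) = 0" "braket w (A *v u) = 0"
    using b by (simp_all add: a_def b_def)
qed

lemma kraus_zero_outcome:
  assumes E: "\<And>\<rho>. \<E> \<rho> = (\<Sum>a=1..(r::nat). E a ** \<rho> ** hermitian_adjoint (E a))"
    and "psd (M j)" and "j \<in> {1..m}"
    and "j \<notin> possible_outcomes \<E> m M (ketbra v v)" and "a \<in> {1..r}"
  shows "braket (E a *v v) (M j *v (E a *v v)) = 0"
proof -
  \<comment> \<open>Each Kraus operator turns the pure state into an unnormalised pure state, so the
    probability splits into expectation values of \<open>M j\<close>.\<close>
  have tr: "trace (\<E> (ketbra v v) ** M j) = (\<Sum>a=1..r. braket (E a *v v) (M j *v (E a *v v)))"
    by (simp add: E ketbra_conjugation sum_matrix_matrix_mult trace_sum trace_ketbra_mult)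
  have nonneg: "0 \<le> braket (E a *v v) (M j *v (E a *v v))" for a
    using assms(2) by (simp add: psd_def)
  \<comment> \<open>The order on complex numbers is partial: failing to be positive means being zero
    only once the sum is known to be nonnegative.\<close>
  have "\<not> 0 < (\<Sum>a=1..r. braket (E a *v v) (M j *v (E a *v v)))"
    using assms(3,4) by (simp add: possible_outcomes_def tr)
  moreover have "0 \<le> (\<Sum>a=1..r. braket (E a *v v) (M j *v (E a *v v)))"
    by (intro sum_nonneg nonneg)
  ultimately have "(\<Sum>a=1..r. braket (E a *v v) (M j *v (E a *v v))) = 0"
    by (simp add: order_less_le)
  then show ?thesis
    using assms(5) nonneg by (simp add: sum_nonneg_eq_0_iff)
qed

theorem proposition4:
  fixes \<E> :: "complex ^ 'n ^ 'n \<Rightarrow> complex ^ 'n ^ 'n"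
    and v\<^sub>1 v\<^sub>2 :: "complex ^ 'n"
  assumes "quantum_channel \<E>"
    and "norm v\<^sub>1 = 1" and "norm v\<^sub>2 = 1"
    and "\<exists>m M. povm m M \<and> non_adjacent \<E> m M (ketbra v\<^sub>1 v\<^sub>1) (ketbra v\<^sub>2 v\<^sub>2)"
  shows "braket v\<^sub>1 v\<^sub>2 = 0"
proof -
  from assms(1) obtain r :: nat and E
    where E1: "(\<Sum>a=1..r. hermitian_adjoint (E a) ** E a) = mat 1"
      and E: "\<And>\<rho>. \<E> \<rho> = (\<Sum>a=1..r. E a ** \<rho> ** hermitian_adjoint (E a))"
    unfolding quantum_channel_def by blast
  from assms(4) obtain m M where psd: "\<And>j. j \<in> {1..m} \<Longrightarrow> psd (M j)"
    and M1: "(\<Sum>j=1..m. M j) = mat 1"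
    and disj: "possible_outcomes \<E> m M (ketbra v\<^sub>1 v\<^sub>1)
      \<inter> possible_outcomes \<E> m M (ketbra v\<^sub>2 v\<^sub>2) = {}"
    unfolding povm_def non_adjacent_def by blast
  have zero: "braket (E a *v v\<^sub>1) (M j *v (E a *v v\<^sub>2)) = 0"
    if a: "a \<in> {1..r}" and j: "j \<in> {1..m}" for a j
  \<comment> \<open>If outcome j is possible for \<open>v\<^sub>1\<close>, it is impossible for
    \<open>v\<^sub>2\<close> and the form of \<open>M j\<close> vanishes at the right-hand vector;
    otherwise it vanishes at the left-hand one.\<close>
  proof (cases "j \<in> possible_outcomes \<E> m M (ketbra v\<^sub>1 v\<^sub>1)")
    case True
    with disj have "j \<notin> possible_outcomes \<E> m M (ketbra v\<^sub>2 v\<^sub>2)" by blast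
    from psd_braket_eq_0(1)[OF psd[OF j] kraus_zero_outcome[OF E psd[OF j] j this a]]
    show ?thesis .
  next
    case False
    from psd_braket_eq_0(2)[OF psd[OF j] kraus_zero_outcome[OF E psd[OF j] j this a]]
    show ?thesis .
  qed
  have "braket v\<^sub>1 v\<^sub>2 = braket v\<^sub>1 ((\<Sum>a=1..r. hermitian_adjoint (E a) ** E a) *v v\<^sub>2)"
    by (simp only: E1 matrix_vector_mul_lid)
  also have "\<dots> = (\<Sum>a=1..r. braket (E a *v v\<^sub>1) (E a *v v\<^sub>2))"
    \<comment> \<open>Moving \<open>E a\<close> across the bracket as its adjoint brings both sides
      to the same form.\<close>
    by (simp add: sum_matrix_vector_mult braket_sum_right braket_matrix_left
        matrix_vector_mul_assoc)
  also have "\<dots> = (\<Sum>a=1..r. braket (E a *v v\<^sub>1) ((\<Sum>j=1..m. M j) *v (E a *v v\<^sub>2)))"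
    by (simp only: M1 matrix_vector_mul_lid)
  also have "\<dots> = (\<Sum>a=1..r. \<Sum>j=1..m. braket (E a *v v\<^sub>1) (M j *v (E a *v v\<^sub>2)))"
    by (simp only: sum_matrix_vector_mult braket_sum_right)
  also have "\<dots> = 0"
    by (intro sum.neutral ballI zero)
  finally show ?thesis .
qed

end
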